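(* Consider the algebraic differential equation $$F(x,y,y')=\sum_{i=1}^n a_i(x)\,y^{p_i}(y')^{q_i}=0,\qquad (1)$$ with polynomial coefficients $a_i\in\mathbb{C}[x]$, and let $x_0\in\mathbb{C}$ be a nonsingular point of (1). Then every formal Puiseux series in powers of $x-x_0$ that satisfies (1) and whose first term is a non-exceptional term $c(x-x_0)^\lambda$ with $\lambda\in\mathbb{Q}$, $\lambda\neq 0$, converges in some small neighborhood of $x_0$.
   Context: In equation (1), the $a_i$ are nonzero polynomials in $x$ with complex coefficients, and the $(p_i,q_i)$ are pairwise distinct pairs of nonnegative integers; $y'=dy/dx$. Nonsingular point: a point $x_0\in\mathbb{C}$ is a singular point of (1) if it is a zero of at least one of the coefficients $a_i$; otherwise it is nonsingular, i.e. $a_i(x_0)\neq 0$ for all $i$. Polygon: put $Q_i=(M_i,N_i)=(p_i+q_i,\,q_i)$, $i=1,\dots,n$, in the plane. The polygon of (1) (corresponding to any nonsingular point) is the convex-up (upper) part of the boundary of the convex hull of $\{Q_1,\dots,Q_n\}$. The polygon has an inclined edge $I_\lambda$ with inner normal vector $(\lambda,-1)$, $\lambda\neq0$, when the set of points of the convex hull where the linear function $L_\lambda(X,Y)=\lambda X-Y$ attains its minimum is a nondegenerate segment (containing at least two of the $Q_i$); this segment is $I_\lambda$. Approximate equation corresponding to $I_\lambda$: $$\hat F_{x_0,\lambda}(y,y')=\sum_{i:\,Q_i\in I_\lambda}a_i(x_0)\,y^{p_i}(y')^{q_i}=0.$$ Characteristic polynomial corresponding to $I_\lambda$: $$P_{x_0,\lambda}(c)=\sum_{i:\,Q_i\in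 I_\lambda}a_i(x_0)\,\lambda^{N_i}c^{M_i}.$$ For $c\in\mathbb{C}\setminus\{0\}$, the function $c(x-x_0)^\lambda$ is a solution of the approximate equation exactly when $P_{x_0,\lambda}(c)=0$. The term $c(x-x_0)^\lambda$ ($c\neq0$) is called non-exceptional if it is a solution of the approximate equation corresponding to an inclined edge $I_\lambda$ of the polygon and $c$ is a simple root of $P_{x_0,\lambda}$. Puiseux series: a formal Puiseux series in powers of $x-x_0$ is a formal Laurent series, with finitely many terms of negative exponent, in $(x-x_0)^{1/k}$ for some positive integer $k$, with complex coefficients; differentiation is termwise, and the series satisfies (1) if substituting it gives zero identically as a formal series. Its first term is its nonzero term of lowest exponent. It converges in a small neighborhood of $x_0$ (has a nonzero radius of convergence) if the corresponding Laurent series in $t=(x-x_0)^{1/k}$ converges for all sufficiently small $t\neq 0$. *)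

theory Defs
  imports "HOL-Complex_Analysis.Complex_Analysis"
begin

text \<open>
  A formal Puiseux series in powers of \<open>x - x0\<close> is represented by a ramification index \<open>k > 0\<close>
  and a formal Laurent series \<open>g\<close> in the uniformizer \<open>t = (x - x0) powr (1/k)\<close>, so that \<open>x = x0 + t ^ k\<close>.
\<close>

text \<open>
  Termwise \<open>d/dx\<close> written in \<open>t\<close>: from \<open>dx = k t^(k-1) dt\<close> it is \<open>(dg/dt) / (k t^(k-1))\<close>.
  See \<open>puiseux_deriv_nth\<close> for the coefficients.
\<close>
definition puiseux_deriv :: "nat \<Rightarrow> complex fls \<Rightarrow> complex fls" where
  "puiseux_deriv k g = fls_const (1 / of_nat k) * fls_shift (int k - 1) (fls_deriv g)"

text \<open>The polynomial \<open>A(x)\<close> as a series in \<open>t\<close>, namely \<open>A(x0 + t ^ k)\<close>.\<close>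
definition puiseux_of_poly :: "complex \<Rightarrow> nat \<Rightarrow> complex poly \<Rightarrow> complex fls" where
  "puiseux_of_poly x0 k A = fps_to_fls (fps_of_poly (pcompose A ([:x0:] + monom 1 k)))"

text \<open>
  \<open>g\<close> satisfies \<open>(\<Sum>i\<in>I. a i (x) * y ^ p i * y' ^ q i) = 0\<close> identically as a formal series.
\<close>
definition puiseux_solution ::
  "nat set \<Rightarrow> (nat \<Rightarrow> complex poly) \<Rightarrow> (nat \<Rightarrow> nat) \<Rightarrow> (nat \<Rightarrow> nat) \<Rightarrow> complex \<Rightarrow> nat \<Rightarrow> complex fls \<Rightarrow> bool"
where
  "puiseux_solution I a p q x0 k g \<longleftrightarrow>
     (\<Sum>i\<in>I. puiseux_of_poly x0 k (a i) * g ^ p i * puiseux_deriv k g ^ q i) = 0"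

definition puiseux_first_term :: "nat \<Rightarrow> complex fls \<Rightarrow> complex \<Rightarrow> real \<Rightarrow> bool" where
  "puiseux_first_term k g c lam \<longleftrightarrow>
     g \<noteq> 0 \<and> lam = of_int (fls_subdegree g) / of_nat k \<and> c = fls_nth g (fls_subdegree g)"

definition nonsingular_point :: "nat set \<Rightarrow> (nat \<Rightarrow> complex poly) \<Rightarrow> complex \<Rightarrow> bool" where
  "nonsingular_point I a x0 \<longleftrightarrow> (\<forall>i\<in>I. poly (a i) x0 \<noteq> 0)"

definition polygon_point :: "(nat \<Rightarrow> nat) \<Rightarrow> (nat \<Rightarrow> nat) \<Rightarrow> nat \<Rightarrow> real \<times> real" where
  "polygon_point p q i = (real (p i + q i), real (q i))"

definition L_form :: "real \<Rightarrow> real \<times> real \<Rightarrow> real" where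
  "L_form lam z = lam * fst z - snd z"

text \<open>
  The points of the convex hull minimizing \<open>L_form lam\<close>.  As \<open>(lam, -1)\<close> is an inner normal pointing
  downwards, this face always lies on the upper part of the boundary.
\<close>
definition polygon_face ::
  "nat set \<Rightarrow> (nat \<Rightarrow> nat) \<Rightarrow> (nat \<Rightarrow> nat) \<Rightarrow> real \<Rightarrow> (real \<times> real) set" where
  "polygon_face I p q lam =
     {z \<in> convex hull (polygon_point p q ` I).
        \<forall>w \<in> convex hull (polygon_point p q ` I). L_form lam z \<le> L_form lam w}"

definition has_inclined_edge ::
  "nat set \<Rightarrow> (nat \<Rightarrow> nat) \<Rightarrow> (nat \<Rightarrow> nat) \<Rightarrow> real \<Rightarrow> bool" where
  "has_inclined_edge I p q lam \<longleftrightarrow>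
     lam \<noteq> 0 \<and> (\<exists>u v. u \<noteq> v \<and> polygon_face I p q lam = closed_segment u v)"

definition edge_indices ::
  "nat set \<Rightarrow> (nat \<Rightarrow> nat) \<Rightarrow> (nat \<Rightarrow> nat) \<Rightarrow> real \<Rightarrow> nat set" where
  "edge_indices I p q lam = {i \<in> I. polygon_point p q i \<in> polygon_face I p q lam}"

definition approx_solution ::
  "nat set \<Rightarrow> (nat \<Rightarrow> complex poly) \<Rightarrow> (nat \<Rightarrow> nat) \<Rightarrow> (nat \<Rightarrow> nat) \<Rightarrow> complex \<Rightarrow> real
    \<Rightarrow> nat \<Rightarrow> complex fls \<Rightarrow> bool"
where
  "approx_solution I a p q x0 lam k g \<longleftrightarrow>
     puiseux_solution (edge_indices I p q lam) (\<lambda>i. [:poly (a i) x0:]) p q x0 k g"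

definition char_poly_edge ::
  "nat set \<Rightarrow> (nat \<Rightarrow> complex poly) \<Rightarrow> (nat \<Rightarrow> nat) \<Rightarrow> (nat \<Rightarrow> nat) \<Rightarrow> complex \<Rightarrow> real \<Rightarrow> complex poly"
where
  "char_poly_edge I a p q x0 lam =
     (\<Sum>i\<in>edge_indices I p q lam. monom (poly (a i) x0 * of_real lam ^ q i) (p i + q i))"

text \<open>
  For rational \<open>lam = m/k\<close> the term \<open>c (x - x0) powr lam\<close> is the monomial \<open>c t ^ m\<close>.  Whether it solves
  the approximate equation does not depend on the representation of \<open>lam\<close> as a fraction
  (\<open>approx_solution_monomial_iff\<close>).  The condition \<open>char_poly_edge \<dots> \<noteq> 0\<close> is there because
  \<open>order c 0\<close> is unspecified.
\<close>
definition nonexceptional_term ::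
  "nat set \<Rightarrow> (nat \<Rightarrow> complex poly) \<Rightarrow> (nat \<Rightarrow> nat) \<Rightarrow> (nat \<Rightarrow> nat) \<Rightarrow> complex \<Rightarrow> complex \<Rightarrow> real \<Rightarrow> bool"
where
  "nonexceptional_term I a p q x0 c lam \<longleftrightarrow>
     c \<noteq> 0 \<and> has_inclined_edge I p q lam \<and>
     (\<exists>k m. k > 0 \<and> lam = of_int m / of_nat k \<and>
        approx_solution I a p q x0 lam k (fls_const c * fls_X_intpow m)) \<and>
     char_poly_edge I a p q x0 lam \<noteq> 0 \<and> order c (char_poly_edge I a p q x0 lam) = 1"

lemma puiseux_deriv_nth:
  "fls_nth (puiseux_deriv k g) j =
     of_int (j + int k) / of_nat k * fls_nth g (j + int k)"
  by (cases "k = 0") (simp_all add: puiseux_deriv_def field_simps)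

lemma L_form_face_eq:
  assumes "i \<in> edge_indices I p q lam" "j \<in> edge_indices I p q lam"
  shows "L_form lam (polygon_point p q i) = L_form lam (polygon_point p q j)"
  using assms unfolding edge_indices_def polygon_face_def by (auto intro: antisym)

lemma puiseux_deriv_monomial:
  assumes "k > 0"
  shows "puiseux_deriv k (fls_const c * fls_X_intpow m) =
           fls_const (of_int m / of_nat k * c) * fls_X_intpow (m - int k)"
proof (rule fls_eqI)
  fix j :: int
  show "fls_nth (puiseux_deriv k (fls_const c * fls_X_intpow m)) j =
          fls_nth (fls_const (of_int m / of_nat k * c) * fls_X_intpow (m - int k)) j"
    by (cases "j = m - int k") (simp_all add: puiseux_deriv_nth)
qed

lemma approx_solution_monomial_iff:
  assumes k: "k > 0" and lam_eq: "lam = of_int m / of_nat k"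
  shows "approx_solution I a p q x0 lam k (fls_const c * fls_X_intpow m) \<longleftrightarrow>
           poly (char_poly_edge I a p q x0 lam) c = 0"
proof (cases "edge_indices I p q lam = {}")
  case True
  then show ?thesis
    by (simp add: approx_solution_def puiseux_solution_def char_poly_edge_def)
next
  case False
  let ?E = "edge_indices I p q lam"
  let ?t = "\<lambda>i. poly (a i) x0 * of_real lam ^ q i * c ^ (p i + q i)"
  obtain j where j: "j \<in> ?E" using False by blast
  define e where "e i = int (p i + q i) * m - int k * int (q i)" for i
  have e: "e i = e j" if "i \<in> ?E" for i
  proof -
    have "real_of_int (e i) = real k * L_form lam (polygon_point p q i)" for i
      using k by (simp add: e_def L_form_def polygon_point_def lam_eq field_simps)
    then show ?thesis using L_form_face_eq[OF that j] by (metis of_int_eq_iff)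
  qed
  have cl: "complex_of_real lam = of_int m / of_nat k" by (simp add: lam_eq)
  have const: "puiseux_of_poly x0 k [:z:] = fls_const z" for z
    by (simp add: puiseux_of_poly_def)
  have pw: "(fls_const z * fls_X_intpow r) ^ s = fls_const (z ^ s) * fls_X_intpow (int s * r)"
    for z :: complex and r s
    by (simp only: power_mult_distrib fls_const_power fls_X_intpow_power)
  have mul: "fls_const u * (fls_const v * fls_X_intpow r) * (fls_const w * fls_X_intpow s)
      = fls_const (u * v * w) * fls_X_intpow (r + s)" for u v w :: complex and r s
  proof -
    have "fls_const u * (fls_const v * fls_X_intpow r) * (fls_const w * fls_X_intpow s)
      = (fls_const u * fls_const v * fls_const w) * (fls_X_intpow r * fls_X_intpow s)"
      by (simp only: mult_ac)
    then show ?thesis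
      by (simp only: fls_X_intpow_times_fls_X_intpow fls_const_mult_const)
  qed
  have fls_const_sum: "(\<Sum>i\<in>A. fls_const (f i)) = fls_const (\<Sum>i\<in>A. f i)"
    for A :: "nat set" and f :: "nat \<Rightarrow> complex"
    by (induction A rule: infinite_finite_induct) (simp_all flip: fls_plus_const)
  have "(\<Sum>i\<in>?E. puiseux_of_poly x0 k [:poly (a i) x0:] * (fls_const c * fls_X_intpow m) ^ p i
           * puiseux_deriv k (fls_const c * fls_X_intpow m) ^ q i)
      = (\<Sum>i\<in>?E. fls_const (?t i) * fls_X_intpow (e j))"
  proof (rule sum.cong[OF refl])
    fix i assume i: "i \<in> ?E"
    have x: "int (p i) * m + int (q i) * (m - int k) = e j"
      using e[OF i] by (simp add: e_def algebra_simps)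
    have y: "poly (a i) x0 * c ^ p i * (of_int m / of_nat k * c) ^ q i = ?t i"
      by (simp only: cl power_add power_mult_distrib mult_ac)
    show "puiseux_of_poly x0 k [:poly (a i) x0:] * (fls_const c * fls_X_intpow m) ^ p i
           * puiseux_deriv k (fls_const c * fls_X_intpow m) ^ q i = fls_const (?t i) * fls_X_intpow (e j)"
      unfolding puiseux_deriv_monomial[OF k] const pw mul x y ..
  qed
  also have "\<dots> = (\<Sum>i\<in>?E. fls_const (?t i)) * fls_X_intpow (e j)"
    by (simp only: sum_distrib_right)
  also have "(\<Sum>i\<in>?E. fls_const (?t i)) = fls_const (\<Sum>i\<in>?E. ?t i)"
    by (rule fls_const_sum)
  also have "(\<Sum>i\<in>?E. ?t i) = poly (char_poly_edge I a p q x0 lam) c"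
    by (simp add: char_poly_edge_def poly_sum poly_monom)
  finally show ?thesis
    unfolding approx_solution_def puiseux_solution_def
    by (simp only: mult_eq_0_iff fls_X_intpow_nonzero simp_thms fls_const_eq_0_iff)
qed

end

theory Submission
  imports Defs
begin

text \<open>
  Writing \<open>x = x0 + t ^ k\<close>, \<open>y = t ^ m * (c + v)\<close> and \<open>w = t * dv/dt\<close>, and dividing by the lowest power
  of \<open>t\<close>, the equation becomes \<open>\<alpha> * v + \<beta> * w + R(t, v, w) = 0\<close>, where every monomial of \<open>R\<close>
  contains \<open>t\<close> or has degree at least 2 in \<open>(v, w)\<close>, and \<open>\<alpha> = P'(c) = k * \<beta>\<close>, which does not
  vanish as \<open>c\<close> is a simple root.  Hence \<open>\<bar>\<alpha> + \<beta> * n\<bar> \<ge> \<bar>\<beta>\<bar> * n\<close>: there are no resonances, and no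
  irregular singularity.  If the partial sum up to \<open>N\<close> of \<open>\<Sum>n. \<bar>w\<^sub>n\<bar> * s ^ (2 * n)\<close> is at most
  \<open>s\<close>, then the partial sum of \<open>R\<close> up to \<open>N + 1\<close> is \<open>O(s\<^sup>2)\<close>, so for small \<open>s\<close> the partial sum of
  \<open>w\<close> up to \<open>N + 1\<close> is again at most \<open>s\<close>.  The partial sums thus stay bounded.
\<close>

section \<open>Weighted partial sums of power series and the Euler derivative\<close>

text \<open>Truncation keeps every bound finite: nothing is known in advance about convergence of
  the formal solution.\<close>

definition pnorm :: "nat \<Rightarrow> real \<Rightarrow> complex fps \<Rightarrow> real" where
  "pnorm N r X = (\<Sum>n\<le>N. norm (fps_nth X n) * r ^ n)"

lemma pnorm_nonneg: "r \<ge> 0 \<Longrightarrow> pnorm N r X \<ge> 0"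
  by (simp add: pnorm_def sum_nonneg)

lemma pnorm_mono: "r \<ge> 0 \<Longrightarrow> N \<le> M \<Longrightarrow> pnorm N r X \<le> pnorm M r X"
  unfolding pnorm_def by (intro sum_mono2) auto

lemma pnorm_add: "r \<ge> 0 \<Longrightarrow> pnorm N r (X + Y) \<le> pnorm N r X + pnorm N r Y"
  unfolding pnorm_def sum.distrib[symmetric]
  by (intro sum_mono) (simp add: norm_triangle_ineq mult_right_mono flip: distrib_right)

lemma pnorm_const_mult: "pnorm N r (fps_const c * X) = norm c * pnorm N r X"
  by (simp add: pnorm_def norm_mult sum_distrib_left mult_ac)

text \<open>The Cauchy product runs over the triangle \<open>i + j \<le> N\<close>; where it does
  not vanish, \<open>nz\<close> puts it inside the box \<open>{..A} \<times> {..B}\<close>. Separate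
  cutoffs matter because a vanishing constant term in one factor lowers the order to which the other
  must be known.\<close>

lemma pnorm_mult:
  assumes r: "r \<ge> 0"
    and nz: "\<And>i j. i + j \<le> N \<Longrightarrow> fps_nth X i \<noteq> 0 \<Longrightarrow> fps_nth Y j \<noteq> 0 \<Longrightarrow> i \<le> A \<and> j \<le> B"
  shows "pnorm N r (X * Y) \<le> pnorm A r X * pnorm B r Y"
proof -
  let ?f = "\<lambda>i j. (norm (fps_nth X i) * r ^ i) * (norm (fps_nth Y j) * r ^ j)"
  let ?T = "{(i, j). i + j \<le> N}"
  have fin: "finite ?T"
    by (rule finite_subset[of _ "{..N} \<times> {..N}"]) auto
  have "pnorm N r (X * Y) \<le> (\<Sum>n\<le>N. \<Sum>i\<le>n. ?f i (n - i))"
    unfolding pnorm_def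
  proof (rule sum_mono)
    fix n
    have "norm (fps_nth (X * Y) n) * r ^ n
        \<le> (\<Sum>i\<le>n. norm (fps_nth X i * fps_nth Y (n - i))) * r ^ n"
      unfolding fps_mult_nth atLeast0AtMost using r by (intro mult_right_mono norm_sum) auto
    also have "\<dots> = (\<Sum>i\<le>n. ?f i (n - i))"
      unfolding sum_distrib_right
    proof (rule sum.cong[OF refl])
      fix i assume "i \<in> {..n}"
      then have "r ^ n = r ^ i * r ^ (n - i)" by (simp flip: power_add)
      then show "norm (fps_nth X i * fps_nth Y (n - i)) * r ^ n = ?f i (n - i)"
        by (simp add: norm_mult)
    qed
    finally show "norm (fps_nth (X * Y) n) * r ^ n \<le> (\<Sum>i\<le>n. ?f i (n - i))" .
  qed
  also have "\<dots> = (\<Sum>(i, j)\<in>?T. ?f i j)"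
    by (rule sum.triangle_reindex_eq[symmetric])
  also have "\<dots> = (\<Sum>(i, j)\<in>?T \<inter> {..A} \<times> {..B}. ?f i j)"
    using nz by (intro sum.mono_neutral_right fin) auto
  also have "\<dots> \<le> (\<Sum>(i, j)\<in>{..A} \<times> {..B}. ?f i j)"
    using r by (intro sum_mono2) auto
  also have "\<dots> = pnorm A r X * pnorm B r Y"
    by (simp add: pnorm_def sum_product sum.cartesian_product)
  finally show ?thesis .
qed

definition theta :: "complex fps \<Rightarrow> complex fps" where
  "theta v = fps_X * fps_deriv v"

lemma theta_nth: "fps_nth (theta v) n = of_nat n * fps_nth v n"
  by (cases n) (simp_all add: theta_def)

text \<open>Makes a bound on \<open>theta v\<close> serve for \<open>v\<close> as well: the factor
  \<open>n\<close> is at least 1 except at \<open>n = 0\<close>, where \<open>v\<close> has no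
  coefficient.\<close>

lemma pnorm_le_theta:
  assumes "r \<ge> 0" "fps_nth v 0 = 0"
  shows "pnorm N r v \<le> pnorm N r (theta v)"
  unfolding pnorm_def
proof (intro sum_mono mult_right_mono)
  fix n
  have "norm (fps_nth v n) \<le> real n * norm (fps_nth v n)"
    using assms(2) by (cases n) (simp_all add: algebra_simps)
  then show "norm (fps_nth v n) \<le> norm (fps_nth (theta v) n)"
    by (simp add: theta_nth norm_mult)
qed (use assms in simp)

section \<open>Estimates in terms of the size of the unknown series\<close>

text \<open>
  Evaluating at \<open>s\<^sup>2\<close> gives the independent variable the same weight 2 as a product of two
  series of size \<open>s\<close>.  With \<open>e = 1\<close> the predicate controls one more coefficient of \<open>X\<close>
  than is assumed about \<open>w\<close>, which drives the induction on the coefficients.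
\<close>
definition dominated :: "complex fps \<Rightarrow> nat \<Rightarrow> nat \<Rightarrow> complex fps \<Rightarrow> bool" where
  "dominated w e d X \<longleftrightarrow> (\<exists>C. \<forall>N s. 0 < s \<longrightarrow> s \<le> 1 \<longrightarrow> pnorm N (s\<^sup>2) w \<le> s \<longrightarrow>
     pnorm (N + e) (s\<^sup>2) X \<le> C * s ^ d)"

lemma dominatedI:
  assumes "\<And>N s. 0 < s \<Longrightarrow> s \<le> 1 \<Longrightarrow> pnorm N (s\<^sup>2) w \<le> s \<Longrightarrow> pnorm (N + e) (s\<^sup>2) X \<le> C * s ^ d"
  shows "dominated w e d X"
  using assms unfolding dominated_def by blast

lemma dominatedE:
  assumes "dominated w e d X"
  obtains C where "C \<ge> 0"
    "\<And>N s. 0 < s \<Longrightarrow> s \<le> 1 \<Longrightarrow> pnorm N (s\<^sup>2) w \<le> s \<Longrightarrow> pnorm (N + e) (s\<^sup>2) X \<le> C * s ^ d"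
proof -
  obtain C where C:
    "\<And>N s. 0 < s \<Longrightarrow> s \<le> 1 \<Longrightarrow> pnorm N (s\<^sup>2) w \<le> s \<Longrightarrow> pnorm (N + e) (s\<^sup>2) X \<le> C * s ^ d"
    using assms unfolding dominated_def by blast
  show thesis
  \<comment> \<open>A nonnegative constant is needed to multiply bounds and to lower the exponent of
    \<open>s\<close>.\<close>
  proof (rule that[of "max C 0"])
    fix N and s :: real
    assume s: "0 < s" "s \<le> 1" "pnorm N (s\<^sup>2) w \<le> s"
    have "C * s ^ d \<le> max C 0 * s ^ d" using s by (intro mult_right_mono) auto
    with C[OF s] show "pnorm (N + e) (s\<^sup>2) X \<le> max C 0 * s ^ d" by linarith
  qed simp
qed

lemma dominated_self: "dominated w 0 1 w"
  by (rule dominatedI[where C = 1]) simp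

lemma dominated_const: "dominated w 0 0 (fps_const a)"
proof (rule dominatedI[where C = "norm a"])
  fix N s
  have "pnorm N (s\<^sup>2) (fps_const a) = (\<Sum>n\<le>N. if n = 0 then norm a else 0)"
    unfolding pnorm_def by (intro sum.cong) auto
  then show "pnorm (N + 0) (s\<^sup>2) (fps_const a) \<le> norm a * s ^ 0" by simp
qed

lemma dominated_add:
  assumes "dominated w e d X" "dominated w e d Y"
  shows "dominated w e d (X + Y)"
proof -
  obtain C where C:
    "\<And>N s. 0 < s \<Longrightarrow> s \<le> 1 \<Longrightarrow> pnorm N (s\<^sup>2) w \<le> s \<Longrightarrow> pnorm (N + e) (s\<^sup>2) X \<le> C * s ^ d"
    using assms(1) by (rule dominatedE) (rule that; assumption)
  obtain D where D:
    "\<And>N s. 0 < s \<Longrightarrow> s \<le> 1 \<Longrightarrow> pnorm N (s\<^sup>2) w \<le> s \<Longrightarrow> pnorm (N + e) (s\<^sup>2) Y \<le> D * s ^ d"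
    using assms(2) by (rule dominatedE) (rule that; assumption)
  show ?thesis
  proof (rule dominatedI[where C = "C + D"])
    fix N and s :: real assume s: "0 < s" "s \<le> 1" "pnorm N (s\<^sup>2) w \<le> s"
    show "pnorm (N + e) (s\<^sup>2) (X + Y) \<le> (C + D) * s ^ d"
      using pnorm_add[of "s\<^sup>2" "N + e" X Y] C[OF s] D[OF s] by (simp add: algebra_simps)
  qed
qed

lemma dominated_const_mult:
  assumes "dominated w e d X"
  shows "dominated w e d (fps_const a * X)"
proof -
  obtain C where C:
    "\<And>N s. 0 < s \<Longrightarrow> s \<le> 1 \<Longrightarrow> pnorm N (s\<^sup>2) w \<le> s \<Longrightarrow> pnorm (N + e) (s\<^sup>2) X \<le> C * s ^ d"
    using assms(1) by (rule dominatedE) (rule that; assumption)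
  show ?thesis
    using C
    by (intro dominatedI[where C = "norm a * C"])
       (simp add: pnorm_const_mult mult.assoc mult_left_mono)
qed

lemma dominated_mono:
  assumes "dominated w e' d' X" "e \<le> e'" "d \<le> d'"
  shows "dominated w e d X"
proof -
  obtain C where "C \<ge> 0" and C:
    "\<And>N s. 0 < s \<Longrightarrow> s \<le> 1 \<Longrightarrow> pnorm N (s\<^sup>2) w \<le> s \<Longrightarrow> pnorm (N + e') (s\<^sup>2) X \<le> C * s ^ d'"
    using assms(1) by (rule dominatedE) (rule that; assumption)
  show ?thesis
  proof (rule dominatedI[where C = C])
    fix N and s :: real assume s: "0 < s" "s \<le> 1" "pnorm N (s\<^sup>2) w \<le> s"
    have "pnorm (N + e) (s\<^sup>2) X \<le> pnorm (N + e') (s\<^sup>2) X"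
      using assms(2) by (intro pnorm_mono) auto
    also have "\<dots> \<le> C * s ^ d'" by (rule C[OF s])
    also have "\<dots> \<le> C * s ^ d"
      using s assms(3) \<open>C \<ge> 0\<close> by (intro mult_left_mono power_decreasing) auto
    finally show "pnorm (N + e) (s\<^sup>2) X \<le> C * s ^ d" .
  qed
qed

text \<open>The gain \<open>e\<close> of the product may exceed \<open>e1\<close> and
  \<open>e2\<close>. For instance, if both factors vanish at 0, coefficient \<open>N + 1\<close> of
  the product involves only their coefficients up to \<open>N\<close>.\<close>

lemma dominated_mult:
  assumes X: "dominated w e1 d1 X" and Y: "dominated w e2 d2 Y"
    and nz: "\<And>N i j. i + j \<le> N + e \<Longrightarrow> fps_nth X i \<noteq> 0 \<Longrightarrow> fps_nth Y j \<noteq> 0 \<Longrightarrow>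
      i \<le> N + e1 \<and> j \<le> N + e2"
  shows "dominated w e (d1 + d2) (X * Y)"
proof -
  obtain C where "C \<ge> 0" and C:
    "\<And>N s. 0 < s \<Longrightarrow> s \<le> 1 \<Longrightarrow> pnorm N (s\<^sup>2) w \<le> s \<Longrightarrow> pnorm (N + e1) (s\<^sup>2) X \<le> C * s ^ d1"
    using X by (rule dominatedE) (rule that; assumption)
  obtain D where D:
    "\<And>N s. 0 < s \<Longrightarrow> s \<le> 1 \<Longrightarrow> pnorm N (s\<^sup>2) w \<le> s \<Longrightarrow> pnorm (N + e2) (s\<^sup>2) Y \<le> D * s ^ d2"
    using Y by (rule dominatedE) (rule that; assumption)
  show ?thesis
  proof (rule dominatedI[where C = "C * D"])
    fix N and s :: real assume s: "0 < s" "s \<le> 1" "pnorm N (s\<^sup>2) w \<le> s"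
    have "pnorm (N + e) (s\<^sup>2) (X * Y) \<le> pnorm (N + e1) (s\<^sup>2) X * pnorm (N + e2) (s\<^sup>2) Y"
      using nz by (intro pnorm_mult) auto
    also have "\<dots> \<le> (C * s ^ d1) * (D * s ^ d2)"
      using s \<open>C \<ge> 0\<close> by (intro mult_mono C D pnorm_nonneg) auto
    finally show "pnorm (N + e) (s\<^sup>2) (X * Y) \<le> C * D * s ^ (d1 + d2)"
      by (simp add: power_add mult_ac)
  qed
qed

section \<open>First-order expansion in the series and its Euler derivative\<close>

text \<open>A Taylor expansion in which \<open>a\<close>, \<open>b\<close>, \<open>d\<close> play
  the role of the value and the partial derivatives in \<open>v\<close> and \<open>theta v\<close>
  at the origin; pure powers of \<open>t\<close> go into \<open>R\<close>. The condition on the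
  constant term of \<open>R\<close> preserves the gain of one coefficient under products.\<close>

definition linearized :: "complex fps \<Rightarrow> complex fps \<Rightarrow> complex \<Rightarrow> complex \<Rightarrow> complex \<Rightarrow> bool" where
  "linearized v X a b d \<longleftrightarrow> (\<exists>R. X = fps_const a + fps_const b * v + fps_const d * theta v + R \<and>
     fps_nth R 0 = 0 \<and> dominated (theta v) 1 2 R)"

lemma dominated_0: "dominated w e d 0"
  by (rule dominatedI[where C = 0]) (simp add: pnorm_def)

lemma linearized_self: "linearized v v 0 1 0"
  unfolding linearized_def by (rule exI[of _ 0]) (simp add: dominated_0)

lemma linearized_theta: "linearized v (theta v) 0 0 1"
  unfolding linearized_def by (rule exI[of _ 0]) (simp add: dominated_0)

lemma linearized_const: "linearized v (fps_const a) a 0 0"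
  unfolding linearized_def by (rule exI[of _ 0]) (simp add: dominated_0)

lemma linearized_add:
  assumes "linearized v X a b d" "linearized v Y a' b' d'"
  shows "linearized v (X + Y) (a + a') (b + b') (d + d')"
proof -
  obtain R where R: "X = fps_const a + fps_const b * v + fps_const d * theta v + R"
      "fps_nth R 0 = 0" "dominated (theta v) 1 2 R"
    using assms(1) unfolding linearized_def by blast
  obtain S where S: "Y = fps_const a' + fps_const b' * v + fps_const d' * theta v + S"
      "fps_nth S 0 = 0" "dominated (theta v) 1 2 S"
    using assms(2) unfolding linearized_def by blast
  show ?thesis
    unfolding linearized_def
    using R S
    by (intro exI[of _ "R + S"])
       (auto intro: dominated_add simp: algebra_simps simp flip: fps_const_add)
qed

lemma linearized_sum:
  assumes "\<And>i. i \<in> A \<Longrightarrow> linearized v (X i) (a i) (b i) (d i)"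
  shows "linearized v (\<Sum>i\<in>A. X i) (\<Sum>i\<in>A. a i) (\<Sum>i\<in>A. b i) (\<Sum>i\<in>A. d i)"
  using assms linearized_const[of v 0]
  by (induction A rule: infinite_finite_induct) (auto intro: linearized_add)

lemma linearized_mult:
  assumes v0: "fps_nth v 0 = 0"
    and X: "linearized v X a b d" and Y: "linearized v Y a' b' d'"
  shows "linearized v (X * Y) (a * a') (a * b' + b * a') (a * d' + d * a')"
proof -
  obtain R where R: "X = fps_const a + fps_const b * v + fps_const d * theta v + R"
      "fps_nth R 0 = 0" "dominated (theta v) 1 2 R"
    using X unfolding linearized_def by blast
  obtain S where S: "Y = fps_const a' + fps_const b' * v + fps_const d' * theta v + S"
      "fps_nth S 0 = 0" "dominated (theta v) 1 2 S"
    using Y unfolding linearized_def by blast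
  define l where "l = fps_const b * v + fps_const d * theta v"
  define l' where "l' = fps_const b' * v + fps_const d' * theta v"
  have l0: "fps_nth l 0 = 0" "fps_nth l' 0 = 0"
    using v0 by (simp_all add: l_def l'_def theta_nth)
  have dv: "dominated (theta v) 0 1 v"
  proof (rule dominatedI[where C = 1])
    fix N and s :: real assume "pnorm N (s\<^sup>2) (theta v) \<le> s"
    then show "pnorm (N + 0) (s\<^sup>2) v \<le> 1 * s ^ 1"
      using pnorm_le_theta[of "s\<^sup>2" v N] v0 by simp
  qed
  have dl: "dominated (theta v) 0 1 l" "dominated (theta v) 0 1 l'"
    unfolding l_def l'_def
    by (intro dominated_add dominated_const_mult dv dominated_self)+
  have bounded: "dominated (theta v) 0 0 Y" "dominated (theta v) 0 0 (fps_const a + l)"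
    unfolding S(1) add.assoc[of "fps_const a'"] l'_def[symmetric]
    using S(3) dl by (auto intro!: dominated_add dominated_const intro: dominated_mono)
  \<comment> \<open>\<open>R\<close> is paired with all of \<open>Y\<close>, and \<open>S\<close>
    only with \<open>X\<close> without \<open>R\<close>, so \<open>R * S\<close> is counted
    once.\<close>
  have eq: "X * Y = fps_const (a * a') + fps_const (a * b' + b * a') * v
      + fps_const (a * d' + d * a') * theta v + (l * l' + R * Y + S * (fps_const a + l))"
    unfolding R(1) S(1) l_def l'_def
    by (simp add: algebra_simps flip: fps_const_add fps_const_mult)
  \<comment> \<open>Here the gained coefficient comes from both constant terms being zero, as
    \<open>l\<close> and \<open>l'\<close> themselves are controlled only up to
    \<open>N\<close>.\<close>
  have "dominated (theta v) 1 (1 + 1) (l * l')"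
  proof (rule dominated_mult[OF dl])
    fix N i j assume "i + j \<le> N + 1" "fps_nth l i \<noteq> 0" "fps_nth l' j \<noteq> 0"
    moreover from this have "i \<noteq> 0" "j \<noteq> 0" using l0 by metis+
    ultimately show "i \<le> N + 0 \<and> j \<le> N + 0" by linarith
  qed
  \<comment> \<open>\<open>Y\<close> is bounded only up to \<open>N\<close>, which suffices because
    \<open>R\<close> has no constant term.\<close>
  moreover have "dominated (theta v) 1 (2 + 0) (R * Y)"
  proof (rule dominated_mult[OF R(3) bounded(1)])
    fix N i j assume "i + j \<le> N + 1" "fps_nth R i \<noteq> 0"
    moreover from this have "i \<noteq> 0" using R(2) by metis
    ultimately show "i \<le> N + 1 \<and> j \<le> N + 0" by linarith
  qed
  moreover have "dominated (theta v) 1 (2 + 0) (S * (fps_const a + l))"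
  proof (rule dominated_mult[OF S(3) bounded(2)])
    fix N i j assume "i + j \<le> N + 1" "fps_nth S i \<noteq> 0"
    moreover from this have "i \<noteq> 0" using S(2) by metis
    ultimately show "i \<le> N + 1 \<and> j \<le> N + 0" by linarith
  qed
  ultimately have "dominated (theta v) 1 2 (l * l' + R * Y + S * (fps_const a + l))"
    by (intro dominated_add) (simp_all add: numeral_2_eq_2)
  then show ?thesis
    unfolding linearized_def using R S l0 eq
    by (intro exI[of _ "l * l' + R * Y + S * (fps_const a + l)"]) simp
qed

lemma linearized_power:
  assumes v0: "fps_nth v 0 = 0" and X: "linearized v X a b d"
  shows "linearized v (X ^ n) (a ^ n) (of_nat n * a ^ (n - 1) * b) (of_nat n * a ^ (n - 1) * d)"
proof (induction n)
  case 0
  show ?case using linearized_const[of v 1] by simp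
next
  case (Suc n)
  \<comment> \<open>At \<open>n = 0\<close> the truncated exponent is harmless: its factor
    \<open>of_nat n\<close> vanishes.\<close>
  have "a * (of_nat n * a ^ (n - 1) * e) + e * a ^ n = of_nat (Suc n) * a ^ n * e" for e
    by (cases n) (simp_all add: algebra_simps)
  then show ?case using linearized_mult[OF v0 X Suc.IH] by simp
qed

text \<open>Since \<open>t\<close> is evaluated at \<open>s\<^sup>2\<close> with
  \<open>s \<le> 1\<close>, every nonconstant monomial is already at most \<open>s\<^sup>2\<close>
  and belongs to the remainder.\<close>

lemma linearized_poly: "linearized v (fps_of_poly f) (coeff f 0) 0 0"
proof -
  let ?R = "fps_of_poly f - fps_const (coeff f 0)"
  let ?C = "\<Sum>n\<le>degree f. norm (coeff f n)"
  have "dominated (theta v) 1 2 ?R"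
  proof (rule dominatedI[where C = ?C])
    fix N and s :: real assume s: "0 < s" "s \<le> 1"
    have "pnorm (N + 1) (s\<^sup>2) ?R
        \<le> (\<Sum>n\<le>N + 1. norm (coeff f n) * s\<^sup>2)"
      unfolding pnorm_def
    proof (rule sum_mono)
      fix n
      show "norm (fps_nth ?R n) * (s\<^sup>2) ^ n \<le> norm (coeff f n) * s\<^sup>2"
      proof (cases n)
        case (Suc m)
        have "(s\<^sup>2) ^ Suc m \<le> (s\<^sup>2) ^ 1"
          using s by (intro power_decreasing) (auto simp: power_le_one)
        then show ?thesis by (simp add: Suc mult_left_mono)
      qed simp
    qed
    also have "\<dots> = (\<Sum>n\<le>N + 1. norm (coeff f n)) * s\<^sup>2"
      by (simp only: sum_distrib_right)
    \<comment> \<open>Cutting at the degree makes the bound independent of \<open>N\<close>.\<close>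
    also have "(\<Sum>n\<le>N + 1. norm (coeff f n)) = (\<Sum>n\<in>{..N + 1} \<inter> {..degree f}. norm (coeff f n))"
      by (intro sum.mono_neutral_right) (auto simp: le_degree)
    also have "\<dots> * s\<^sup>2 \<le> ?C * s\<^sup>2"
      by (intro mult_right_mono sum_mono2) auto
    finally show "pnorm (N + 1) (s\<^sup>2) ?R \<le> ?C * s\<^sup>2" by simp
  qed
  then show ?thesis
    unfolding linearized_def by (intro exI[of _ ?R]) simp
qed

section \<open>Convergence for equations of Briot-Bouquet type\<close>

text \<open>The divisors grow at least like \<open>n\<close>, which is exactly the factor between
  the coefficients of \<open>v\<close> and \<open>theta v\<close>; hence the remainder may depend on
  \<open>theta v\<close> without loss.\<close>

lemma briot_bouquet_conv_radius:
  assumes v0: "fps_nth v 0 = 0" and lin: "linearized v 0 0 \<alpha> \<beta>"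
    and \<delta>: "\<delta> > 0" "\<And>n. norm (\<alpha> + \<beta> * of_nat n) \<ge> \<delta> * real n"
  shows "fps_conv_radius v > 0"
proof -
  obtain R where R: "0 = fps_const \<alpha> * v + fps_const \<beta> * theta v + R"
      "dominated (theta v) 1 2 R"
    using lin unfolding linearized_def by auto
  obtain C where C: "C \<ge> 0"
    "\<And>N s. 0 < s \<Longrightarrow> s \<le> 1 \<Longrightarrow> pnorm N (s\<^sup>2) (theta v) \<le> s \<Longrightarrow> pnorm (N + 1) (s\<^sup>2) R \<le> C * s\<^sup>2"
    using R(2) by (rule dominatedE) (rule that; assumption)
  have coeff: "\<delta> * norm (fps_nth (theta v) n) \<le> norm (fps_nth R n)" for n
  proof -
    have "fps_nth R n = - ((\<alpha> + \<beta> * of_nat n) * fps_nth v n)"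
      using arg_cong[OF R(1), of "\<lambda>f. fps_nth f n"]
      by (simp add: theta_nth algebra_simps add_eq_0_iff)
    then have "norm (fps_nth R n) = norm (\<alpha> + \<beta> * of_nat n) * norm (fps_nth v n)"
      by (simp add: norm_mult)
    also have "\<dots> \<ge> (\<delta> * real n) * norm (fps_nth v n)"
      by (intro mult_right_mono \<delta>) auto
    finally show ?thesis by (simp add: theta_nth norm_mult mult_ac)
  qed
  \<comment> \<open>Chosen so that \<open>C * s \<le> \<delta>\<close>, which closes the induction;
    \<open>C + 1\<close> avoids division by zero.\<close>
  define s where "s = min 1 (\<delta> / (C + 1))"
  have s: "0 < s" "s \<le> 1" using \<delta> C(1) by (auto simp: s_def)
  have "s \<le> \<delta> / (C + 1)" by (simp add: s_def)
  then have "(C + 1) * s \<le> \<delta>" using C(1) by (simp add: field_simps)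
  then have Cs: "C * s \<le> \<delta>" using s by (simp add: algebra_simps)
  have bound: "pnorm N (s\<^sup>2) (theta v) \<le> s" for N
  proof (induction N)
    case 0
    show ?case using s by (simp add: pnorm_def theta_nth)
  next
    case (Suc N)
    have "\<delta> * pnorm (Suc N) (s\<^sup>2) (theta v) \<le> pnorm (Suc N) (s\<^sup>2) R"
      unfolding pnorm_def sum_distrib_left mult.assoc[symmetric]
      by (intro sum_mono mult_right_mono coeff) auto
    also have "\<dots> \<le> (C * s) * s"
      using C(2)[OF s Suc.IH] by (simp add: power2_eq_square mult.assoc)
    also have "\<dots> \<le> \<delta> * s" using Cs s by (intro mult_right_mono) auto
    finally show ?case using \<delta> by simp
  qed
  have "summable (\<lambda>n. norm (fps_nth v n * of_real (s\<^sup>2) ^ n))"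
  proof (rule bounded_imp_summable)
    show "(\<Sum>n\<le>N. norm (fps_nth v n * of_real (s\<^sup>2) ^ n)) \<le> s" for N
      using pnorm_le_theta[of "s\<^sup>2" v N] v0 bound[of N]
      by (simp add: pnorm_def norm_mult norm_power)
  qed simp
  then have "conv_radius (fps_nth v) \<ge> norm (complex_of_real (s\<^sup>2))"
    by (rule conv_radius_geI[OF summable_norm_cancel])
  moreover have "ereal (norm (complex_of_real (s\<^sup>2))) > 0" using s by simp
  ultimately show ?thesis unfolding fps_conv_radius_def by (rule order.strict_trans2[rotated])
qed

section \<open>Differential monomials and Puiseux series written as power series\<close>

text \<open>Treats one term of the equation, with \<open>U\<close> and \<open>D\<close> the power
  series factors of \<open>y\<close> and \<open>y'\<close>. The derivatives are stated times
  \<open>c\<close> and \<open>l * c\<close>, so that they become multiples of the leading value and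
  the exponents \<open>p - 1\<close> and \<open>q - 1\<close> disappear.\<close>

lemma linearized_monomial:
  assumes v0: "fps_nth v 0 = 0" and Z: "linearized v Z z 0 0"
    and U: "linearized v U c 1 0" and D: "linearized v D (l * c) l r"
  shows "\<exists>b d. linearized v (Z * U ^ p * D ^ q) (z * l ^ q * c ^ (p + q)) b d \<and>
    c * b = of_nat (p + q) * (z * l ^ q * c ^ (p + q)) \<and>
    l * c * d = r * of_nat q * (z * l ^ q * c ^ (p + q))"
proof -
  have pw: "x * (of_nat m * x ^ (m - 1)) = of_nat m * x ^ m" for x :: complex and m
    by (cases m) simp_all
  note lin = linearized_mult[OF v0 linearized_mult[OF v0 Z linearized_power[OF v0 U, of p]]
      linearized_power[OF v0 D, of q]]
  let ?b = "z * c ^ p * (of_nat q * (l * c) ^ (q - 1) * l)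
    + z * (of_nat p * c ^ (p - 1)) * (l * c) ^ q"
  let ?d = "z * c ^ p * (of_nat q * (l * c) ^ (q - 1) * r)"
  have "linearized v (Z * U ^ p * D ^ q) (z * l ^ q * c ^ (p + q)) ?b ?d"
    using lin by (simp add: power_add power_mult_distrib mult_ac)
  moreover have "c * ?b = z * c ^ p * ((l * c) * (of_nat q * (l * c) ^ (q - 1)))
      + z * (c * (of_nat p * c ^ (p - 1))) * (l * c) ^ q"
    by (simp only: algebra_simps)
  then have "c * ?b = of_nat (p + q) * (z * l ^ q * c ^ (p + q))"
    unfolding pw by (simp add: power_add power_mult_distrib algebra_simps)
  moreover have "l * c * ?d = z * c ^ p * ((l * c) * (of_nat q * (l * c) ^ (q - 1))) * r"
    by (simp only: mult_ac)
  then have "l * c * ?d = r * of_nat q * (z * l ^ q * c ^ (p + q))"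
    unfolding pw by (simp add: power_add power_mult_distrib mult_ac)
  ultimately show ?thesis by blast
qed

text \<open>The \<open>t\<close>-derivative of \<open>t ^ m * u\<close> is
  \<open>t ^ (m - 1) * (m * u + theta u)\<close>, and
  \<open>dx = k * t ^ (k - 1) * dt\<close>.\<close>

lemma puiseux_deriv_shift:
  assumes "k > 0"
  shows "puiseux_deriv k (fls_X_intpow m * fps_to_fls u) = fls_X_intpow (m - int k) *
    fps_to_fls (fps_const (of_int m / of_nat k) * u + fps_const (1 / of_nat k) * theta u)"
proof (rule fls_eqI)
  fix j
  let ?n = "nat (j + int k - m)"
  have "of_int (j + int k) = (of_int m + of_nat ?n :: complex)" if "j + int k - m \<ge> 0"
    using that by (metis add_diff_cancel_left' diff_add_cancel of_int_add of_int_of_nat_eq int_nat_eq)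
  then show "fls_nth (puiseux_deriv k (fls_X_intpow m * fps_to_fls u)) j
     = fls_nth (fls_X_intpow (m - int k) *
    fps_to_fls (fps_const (of_int m / of_nat k) * u + fps_const (1 / of_nat k) * theta u)) j"
    unfolding puiseux_deriv_nth fls_X_intpow_times_conv_shift fls_shift_nth fps_to_fls_nth
    using assms
    by (simp add: theta_nth add_divide_distrib algebra_simps)
qed

lemma fps_to_fls_sum: "fps_to_fls (\<Sum>i\<in>A. f i) = (\<Sum>i\<in>A. fps_to_fls (f i))"
  by (induction A rule: infinite_finite_induct) simp_all

lemma coeff_0_pcompose_shift:
  assumes "k > 0"
  shows "coeff (pcompose A ([:x0:] + monom 1 k)) 0 = poly A x0"
proof -
  have "coeff (pcompose A ([:x0:] + monom 1 k)) 0 = poly (pcompose A ([:x0:] + monom 1 k)) 0"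
    by (simp add: poly_0_coeff_0)
  then show ?thesis using assms by (simp add: poly_pcompose poly_monom power_0_left)
qed

section \<open>The polygon edge and its characteristic polynomial\<close>

text \<open>Replaces minimization over the hull by comparison with one known edge index: each point
  of the equation lies in the hull, and a hull point with the same value as a minimizer is a
  minimizer.\<close>

lemma edge_indices_iff:
  assumes "j \<in> edge_indices I p q lam" "i \<in> I"
  shows "L_form lam (polygon_point p q j) \<le> L_form lam (polygon_point p q i)"
    and "i \<in> edge_indices I p q lam \<longleftrightarrow>
      L_form lam (polygon_point p q i) = L_form lam (polygon_point p q j)"
proof -
  have hull: "polygon_point p q i \<in> convex hull (polygon_point p q ` I)"
    using assms(2) by (intro hull_inc imageI)
  with assms(1) show "L_form lam (polygon_point p q j) \<le> L_form lam (polygon_point p q i)"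
    unfolding edge_indices_def polygon_face_def by blast
  show "i \<in> edge_indices I p q lam \<longleftrightarrow>
      L_form lam (polygon_point p q i) = L_form lam (polygon_point p q j)"
  proof
    assume "L_form lam (polygon_point p q i) = L_form lam (polygon_point p q j)"
    then show "i \<in> edge_indices I p q lam"
      using hull assms by (simp add: edge_indices_def polygon_face_def)
  qed (rule L_form_face_eq[OF _ assms(1)])
qed

text \<open>Multiplying by \<open>c\<close> restores each monomial with weight
  \<open>p i + q i\<close>, the form that \<open>linearized_monomial\<close> gives for
  \<open>c * b\<close>.\<close>

lemma poly_pderiv_char_poly_edge:
  "c * poly (pderiv (char_poly_edge I a p q x0 lam)) c = (\<Sum>i\<in>edge_indices I p q lam.
     of_nat (p i + q i) * (poly (a i) x0 * of_real lam ^ q i * c ^ (p i + q i)))"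
proof -
  have "c * (of_nat r * b * c ^ (r - 1)) = of_nat r * (b * c ^ r)" for r b
    by (cases r) simp_all
  then show ?thesis
    unfolding char_poly_edge_def higher_pderiv_sum[where n = 1, simplified] poly_sum
      sum_distrib_left pderiv_monom poly_monom
    by (intro sum.cong refl)
qed

section \<open>Reduction of the equation to Briot-Bouquet form\<close>

theorem theorem2:
  fixes n :: nat and a :: "nat \<Rightarrow> complex poly" and p q :: "nat \<Rightarrow> nat"
    and x0 c :: complex and k :: nat and g :: "complex fls" and lam :: real
  assumes "\<And>i. i \<in> {1..n} \<Longrightarrow> a i \<noteq> 0"
    and "inj_on (\<lambda>i. (p i, q i)) {1..n}"
    and "nonsingular_point {1..n} a x0"
    and "k > 0"
    and "puiseux_solution {1..n} a p q x0 k g"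
    and "puiseux_first_term k g c lam"
    and "lam \<in> \<rat>" and "lam \<noteq> 0"
    and "nonexceptional_term {1..n} a p q x0 c lam"
  shows "fls_conv_radius g > 0"
proof -
  let ?I = "{1..n}"
  let ?E = "edge_indices ?I p q lam"
  let ?P = "char_poly_edge ?I a p q x0 lam"
  let ?L = "\<lambda>i. L_form lam (polygon_point p q i)"
  define m where "m = fls_subdegree g"
  \<comment> \<open>Thus \<open>g = t ^ m * u\<close> with a power series \<open>u\<close> whose
    constant term is \<open>c\<close>; the integer \<open>m\<close> may be negative.\<close>
  define u where "u = fls_base_factor_to_fps g"
  define v where "v = u - fps_const c"
  define l where "l = complex_of_real lam"
  have lam: "lam = of_int m / of_nat k" and c: "c = fps_nth u 0"
    using assms(6) by (auto simp: puiseux_first_term_def m_def u_def)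
  have l: "l = of_int m / of_nat k" "l \<noteq> 0"
    using assms(8) lam by (auto simp: l_def)
  have "c \<noteq> 0" and P: "?P \<noteq> 0" "order c ?P = 1"
    using assms(9) by (auto simp: nonexceptional_term_def)
  have v0: "fps_nth v 0 = 0" by (simp add: v_def c)
  have "?E \<noteq> {}" using P(1) by (auto simp: char_poly_edge_def)
  then obtain j where j: "j \<in> ?E" by blast
  \<comment> \<open>The exponent \<open>p i * m + q i * (m - k)\<close> of the power of
    \<open>t\<close> split off from \<open>y ^ p i * y' ^ q i\<close>. It is \<open>k\<close> times
    the value of the linear form, so the edge consists of the terms of lowest order.\<close>
  define e where "e i = int (p i + q i) * m - int k * int (q i)" for i
  have e: "real_of_int (e i) = real k * ?L i" for i
    using \<open>k > 0\<close> by (simp add: e_def L_form_def polygon_point_def lam field_simps)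
  have e_min: "e j \<le> e i" if "i \<in> ?I" for i
  proof -
    have "real k * ?L j \<le> real k * ?L i"
      using edge_indices_iff(1)[OF j that] by (intro mult_left_mono) auto
    then show ?thesis by (simp flip: e)
  qed
  have e_edge: "e i = e j \<longleftrightarrow> i \<in> ?E" if "i \<in> ?I" for i
  proof -
    have "e i = e j \<longleftrightarrow> real k * ?L i = real k * ?L j" by (simp flip: e)
    then show ?thesis using edge_indices_iff(2)[OF j that] \<open>k > 0\<close> by simp
  qed
  define D where "D = fps_const l * u + fps_const (1 / of_nat k) * theta u"
  \<comment> \<open>The surplus power of \<open>t\<close> left after division by
    \<open>t ^ e j\<close> is absorbed into the polynomial coefficient. By \<open>e_min\<close>,
    \<open>nat\<close> loses nothing for the terms of the equation.\<close>
  define B where "B i = monom 1 (nat (e i - e j)) * pcompose (a i) ([:x0:] + monom 1 k)" for i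
  define T where "T i = fps_of_poly (B i) * u ^ p i * D ^ q i" for i
  have g: "g = fls_X_intpow m * fps_to_fls u"
    using fls_conv_base_factor_to_fps_shift_subdegree[of g]
    by (simp add: m_def u_def fls_X_intpow_times_conv_shift)
  have g': "puiseux_deriv k g = fls_X_intpow (m - int k) * fps_to_fls D"
    using puiseux_deriv_shift[OF \<open>k > 0\<close>, of m u] by (simp only: g D_def l)
  have "puiseux_of_poly x0 k (a i) * g ^ p i * puiseux_deriv k g ^ q i
      = fls_X_intpow (e j) * fps_to_fls (T i)" if "i \<in> ?I" for i
  proof -
    let ?F = "fps_of_poly (pcompose (a i) ([:x0:] + monom 1 k))"
    have X: "fps_to_fls (fps_X ^ nat (e i - e j)) = (fls_X_intpow (e i - e j) :: complex fls)"
      using e_min[OF that] by (simp add: fps_to_fls_power fls_X_power_conv_shift_1)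
    have "T i = fps_X ^ nat (e i - e j) * (?F * u ^ p i * D ^ q i)"
      by (simp add: T_def B_def fps_of_poly_mult fps_of_poly_monom mult_ac)
    then have "fls_X_intpow (e j) * fps_to_fls (T i)
        = fls_X_intpow (e i) * fps_to_fls (?F * u ^ p i * D ^ q i)"
      by (simp only: fls_times_fps_to_fls X mult.assoc[symmetric] fls_X_intpow_times_fls_X_intpow)
         simp
    also have "fls_X_intpow (e i)
        = (fls_X_intpow (int (p i) * m) * fls_X_intpow (int (q i) * (m - int k)) :: complex fls)"
      unfolding fls_X_intpow_times_fls_X_intpow e_def by (simp add: algebra_simps)
    \<comment> \<open>\<open>g'\<close> is rewritten before \<open>g\<close>, since expanding
      \<open>g\<close> first would destroy the redex \<open>puiseux_deriv k g\<close>.\<close>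
    finally show ?thesis
      unfolding puiseux_of_poly_def g'
      unfolding g power_mult_distrib fls_X_intpow_power
      by (simp only: fls_times_fps_to_fls fps_to_fls_power mult_ac)
  qed
  then have "(\<Sum>i\<in>?I. fls_X_intpow (e j) * fps_to_fls (T i)) = 0"
    using assms(5) unfolding puiseux_solution_def by simp
  then have "fls_X_intpow (e j) * fps_to_fls (\<Sum>i\<in>?I. T i) = 0"
    by (simp only: fps_to_fls_sum sum_distrib_left)
  then have T_sum: "(\<Sum>i\<in>?I. T i) = 0"
    by (simp only: mult_eq_0_iff fls_X_intpow_nonzero simp_thms fps_to_fls_eq_0_iff)

  define z where "z i = coeff (B i) 0" for i
  define t where "t i = z i * l ^ q i * c ^ (p i + q i)" for i
  \<comment> \<open>Off the edge the surplus exponent is positive, so the constant coefficient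
    vanishes; this is how the characteristic polynomial emerges.\<close>
  have z: "z i = (if i \<in> ?E then poly (a i) x0 else 0)" if "i \<in> ?I" for i
    using e_min[OF that] e_edge[OF that] coeff_0_pcompose_shift[OF \<open>k > 0\<close>, of "a i" x0]
    by (auto simp: z_def B_def coeff_mult_0 coeff_monom)
  have u_eq: "u = v + fps_const c" by (simp add: v_def)
  have theta_u: "theta u = theta v" by (simp add: u_eq theta_def)
  have lin_u: "linearized v u c 1 0"
    using linearized_add[OF linearized_self linearized_const[of v c]] by (simp add: u_eq)
  have "linearized v D (l * c) l (1 / of_nat k)"
    using linearized_add[OF linearized_mult[OF v0 linearized_const[of v l] lin_u]
        linearized_mult[OF v0 linearized_const[of v "1 / of_nat k"] linearized_theta]]
    by (simp add: D_def theta_u)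
  from linearized_monomial[OF v0 linearized_poly lin_u this]
  have "\<forall>i. \<exists>b d. linearized v (T i) (t i) b d \<and> c * b = of_nat (p i + q i) * t i \<and>
      l * c * d = 1 / of_nat k * of_nat (q i) * t i"
    unfolding T_def t_def z_def by blast
  then obtain b d where bd: "\<And>i. linearized v (T i) (t i) (b i) (d i)"
      "\<And>i. c * b i = of_nat (p i + q i) * t i"
      "\<And>i. l * c * d i = 1 / of_nat k * of_nat (q i) * t i"
    by metis
  define \<alpha> where "\<alpha> = (\<Sum>i\<in>?I. b i)"
  define \<beta> where "\<beta> = (\<Sum>i\<in>?I. d i)"
  have E_sum: "(\<Sum>i\<in>?I. f i * t i)
      = (\<Sum>i\<in>?E. f i * (poly (a i) x0 * l ^ q i * c ^ (p i + q i)))" for f :: "nat \<Rightarrow> complex"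
  proof -
    have "?E \<subseteq> ?I" by (auto simp: edge_indices_def)
    then show ?thesis
      by (intro sum.mono_neutral_cong_right) (auto simp: t_def z)
  qed
  have t_sum: "(\<Sum>i\<in>?I. t i) = 0"
  proof -
    have "poly ?P c = 0" using P by (simp add: order_root)
    then show ?thesis
      using E_sum[of "\<lambda>_. 1"] by (simp add: char_poly_edge_def poly_sum poly_monom l_def)
  qed
  have "c * \<alpha> = c * poly (pderiv ?P) c"
    unfolding \<alpha>_def sum_distrib_left bd(2) E_sum poly_pderiv_char_poly_edge l_def ..
  moreover have "poly (pderiv ?P) c \<noteq> 0"
  proof
    assume "poly (pderiv ?P) c = 0"
    moreover have "order c ?P = Suc (order c (pderiv ?P))"
      using P by (intro order_pderiv) (auto simp: order_root)
    \<comment> \<open>\<open>order c 0\<close> is unspecified, so a zero derivative is excluded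
      separately: a constant polynomial with a root would be zero.\<close>
    moreover have "pderiv ?P \<noteq> 0"
    proof
      assume "pderiv ?P = 0"
      then obtain b where "?P = [:b:]" by (auto simp: pderiv_eq_0_iff elim: degree_eq_zeroE)
      moreover have "poly ?P c = 0" using P by (simp add: order_root)
      ultimately show False using P(1) by simp
    qed
    ultimately show False using P by (simp add: order_root)
  qed
  ultimately have "\<alpha> \<noteq> 0" using \<open>c \<noteq> 0\<close> by auto
  text \<open>On the edge \<open>q i = lam (p i + q i) - const\<close>, and the constant drops out because \<open>c\<close> is a root.\<close>
  have \<alpha>_eq: "\<alpha> = of_nat k * \<beta>"
  proof -
    have q: "of_nat (q i) * t i = l * (of_nat (p i + q i) * t i) - of_real (?L j) * t i"
      if "i \<in> ?I" for i
    proof (cases "i \<in> ?E")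
      case True
      then have "real (q i) = lam * real (p i + q i) - ?L j"
        using L_form_face_eq[OF True j] by (simp add: L_form_def polygon_point_def)
      then have "complex_of_real (real (q i)) = of_real (lam * real (p i + q i) - ?L j)"
        by (rule arg_cong)
      then have "of_nat (q i) = l * of_nat (p i + q i) - of_real (?L j)"
        by (simp add: l_def)
      then show ?thesis by (simp only: left_diff_distrib mult.assoc)
    next
      case False
      then have "t i = 0" using z[OF that] by (simp add: t_def)
      then show ?thesis by simp
    qed
    have "l * c * (of_nat k * \<beta>) = of_nat k * (\<Sum>i\<in>?I. l * c * d i)"
      by (simp add: \<beta>_def sum_distrib_left mult_ac)
    also have "\<dots> = (\<Sum>i\<in>?I. of_nat (q i) * t i)"
      unfolding bd(3) using \<open>k > 0\<close> by (simp add: sum_distrib_left)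
    also have "\<dots> = (\<Sum>i\<in>?I. l * (c * b i) - of_real (?L j) * t i)"
      unfolding bd(2) by (intro sum.cong refl q)
    also have "\<dots> = l * c * \<alpha> - of_real (?L j) * (\<Sum>i\<in>?I. t i)"
      by (simp add: sum_subtractf sum_distrib_left \<alpha>_def mult.assoc)
    finally show ?thesis using t_sum \<open>c \<noteq> 0\<close> l(2) by simp
  qed
  have "linearized v (\<Sum>i\<in>?I. T i) (\<Sum>i\<in>?I. t i) \<alpha> \<beta>"
    unfolding \<alpha>_def \<beta>_def by (intro linearized_sum bd)
  then have "linearized v 0 0 \<alpha> \<beta>" by (simp only: T_sum t_sum)
  then have "fps_conv_radius v > 0"
  proof (rule briot_bouquet_conv_radius[OF v0])
    show "norm \<beta> > 0" using \<open>\<alpha> \<noteq> 0\<close> \<alpha>_eq by auto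
    show "norm (\<alpha> + \<beta> * of_nat r) \<ge> norm \<beta> * real r" for r
    proof -
      have "\<alpha> + \<beta> * of_nat r = \<beta> * of_nat (k + r)" by (simp add: \<alpha>_eq algebra_simps)
      then have "norm (\<alpha> + \<beta> * of_nat r) = norm \<beta> * real (k + r)"
        by (simp only: norm_mult norm_of_nat)
      then show ?thesis by (simp add: mult_left_mono)
    qed
  qed
  then have "fps_conv_radius u > 0"
    using fps_conv_radius_add[of v "fps_const c"] by (simp add: u_eq order.strict_trans2)
  then show ?thesis by (simp add: fls_conv_radius_altdef u_def)
qed

end
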